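(* Let $n,k\ge 1$ and let ${\bf C}=(C_0,C_1,\dots,C_k)$ be a $(k+1)$-tuple of real $n\times n$ matrices. If ${\bf C}$ has the $R_0$-$W$ property, then the solution set $\mathrm{SOL}({\bf C},{\bf d},q)$ of the extended horizontal linear complementarity problem is bounded for every $q\in\mathbb{R}^n$ and every ${\bf d}=(d_1,\dots,d_{k-1})\in(\mathbb{R}^n_{++})^{k-1}$.
   Context: Notation: $[k]=\{1,\dots,k\}$; $\mathbb{R}^n_{++}$ is the set of vectors in $\mathbb{R}^n$ with all entries positive; $x\wedge y$ is the componentwise minimum of $x,y\in\mathbb{R}^n$. Extended horizontal linear complementarity problem: given ${\bf C}=(C_0,\dots,C_k)$ with $C_i\in\mathbb{R}^{n\times n}$, $q\in\mathbb{R}^n$ and ${\bf d}=(d_1,\dots,d_{k-1})\in(\mathbb{R}^n_{++})^{k-1}$ (empty if $k=1$), $\mathrm{EHLCP}({\bf C},{\bf d},q)$ asks for $(x_0,x_1,\dots,x_k)\in(\mathbb{R}^n)^{k+1}$ with $$C_0x_0=q+\sum_{i=1}^k C_ix_i,\qquad x_0\wedge x_1=0,\qquad (d_j-x_j)\wedge x_{j+1}=0\ \ (1\le j\le k-1).$$ $\mathrm{SOL}({\bf C},{\bf d},q)\subseteq(\mathbb{R}^n)^{k+1}$ denotes the set of all its solutions. ${\bf C}$ has the $R_0$-$W$ property if the only $(x_0,\dots,x_k)\in(\mathbb{R}^n)^{k+1}$ satisfying $C_0x_0=\sum_{i=1}^kC_ix_i$ and $x_0\wedge x_j=0$ for all $j\in[k]$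 is the zero vector. *)

theory Defs
  imports "HOL-Analysis.Analysis"
begin

text \<open>
  A tuple indexed by a finite set \<open>I\<close> of naturals is a function on \<open>nat\<close> of which only the
  values on \<open>I\<close> matter: \<open>C\<close> is used on \<open>{0..k}\<close> and \<open>d\<close> on \<open>{1..<k}\<close>. Where a set of tuples
  is formed, the tuples are taken from \<open>{0..k} \<rightarrow>\<^sub>E UNIV\<close>, which stands for the
  \<open>(k+1)\<close>-fold product of \<open>real ^ 'n\<close>. The componentwise minimum is the library's \<open>inf\<close>
  on \<open>real ^ 'n\<close>.
\<close>

text \<open>
  Strict positivity is spelled out by components, since \<open>0 < v\<close> on \<open>real ^ 'n\<close> only means
  \<open>0 \<le> v\<close> and \<open>v \<noteq> 0\<close>.
\<close>

definition pos_vecs :: "(real ^ 'n) set" where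
  "pos_vecs = {v. \<forall>l. 0 < v $ l}"

definition SOL ::
  "nat \<Rightarrow> (nat \<Rightarrow> real ^ 'n ^ 'n) \<Rightarrow> (nat \<Rightarrow> real ^ 'n) \<Rightarrow> real ^ 'n \<Rightarrow> (nat \<Rightarrow> real ^ 'n) set" where
  "SOL k C d q =
    {x \<in> {0..k} \<rightarrow>\<^sub>E UNIV.
       C 0 *v x 0 = q + (\<Sum>i=1..k. C i *v x i) \<and>
       inf (x 0) (x 1) = 0 \<and>
       (\<forall>j\<in>{1..<k}. inf (d j - x j) (x (j + 1)) = 0)}"

definition R0_W :: "nat \<Rightarrow> (nat \<Rightarrow> real ^ 'n ^ 'n) \<Rightarrow> bool" where
  "R0_W k C \<longleftrightarrow>
    (\<forall>x \<in> {0..k} \<rightarrow>\<^sub>E UNIV.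
       C 0 *v x 0 = (\<Sum>i=1..k. C i *v x i) \<and> (\<forall>j\<in>{1..k}. inf (x 0) (x j) = 0) \<longrightarrow>
       (\<forall>i\<in>{0..k}. x i = 0))"

text \<open>
  Boundedness for the Euclidean norm of the \<open>(k+1)\<close>-fold product, which is the \<open>L2_set\<close> below.
  The library's \<open>bounded\<close> on functions from \<open>nat\<close> cannot be used: it refers to the
  metric of the product topology, which is bounded, so that every set would qualify.
\<close>

definition tuples_bounded :: "nat \<Rightarrow> (nat \<Rightarrow> real ^ 'n) set \<Rightarrow> bool" where
  "tuples_bounded k S \<longleftrightarrow> (\<exists>B. \<forall>x\<in>S. L2_set (\<lambda>i. norm (x i)) {0..k} \<le> B)"

end

theory Submission
  imports Defs
begin

text \<open>
  In a solution, positivity of an entry of \<open>x 0\<close> propagates along the chain: it forces that entry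
  of \<open>x 1\<close> to vanish, hence \<open>d 1 - x 1\<close> to be positive there, hence that entry of \<open>x 2\<close> to
  vanish, and so on. Thus \<open>inf (x 0) (x j) = 0\<close> for all \<open>j\<close>, so solutions lie in the closed cone
  appearing in the \<open>R\<^sub>0\<close>-\<open>W\<close> property. On the unit sphere of this cone, the
  residual \<open>C 0 x 0 - (\<Sum>i. C i x i)\<close> vanishes nowhere, so by compactness and homogeneity its norm
  is at least \<open>c > 0\<close> times the norm of \<open>x\<close>. For solutions the residual is \<open>q\<close>.
\<close>

lemma inf_eq_0_iff_vec:
  fixes a b :: "real ^ 'n"
  shows "inf a b = 0 \<longleftrightarrow> (\<forall>l. min (a $ l) (b $ l) = 0)"
  by (simp add: vec_eq_iff inf_vec_def inf_min)

lemma inf_scaleR_eq_0: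
  fixes a b :: "real ^ 'n"
  assumes "inf a b = 0" "0 \<le> t"
  shows "inf (t *\<^sub>R a) (t *\<^sub>R b) = 0"
proof -
  have "min (t * a $ l) (t * b $ l) = t * min (a $ l) (b $ l)" for l
    using assms(2) by (simp add: min_mult_distrib_left)
  with assms(1) show ?thesis by (simp add: inf_eq_0_iff_vec)
qed

lemma SOL_inf_eq_0:
  fixes x :: "nat \<Rightarrow> real ^ 'n"
  assumes x: "x \<in> SOL k C d q" and d: "d \<in> {1..<k} \<rightarrow> pos_vecs" and j: "j \<in> {1..k}"
  shows "inf (x 0) (x j) = 0"
proof -
  have x01: "min (x 0 $ l) (x 1 $ l) = 0" for l
    using x by (simp add: SOL_def inf_eq_0_iff_vec)
  have chain: "min (d i $ l - x i $ l) (x (i + 1) $ l) = 0" if "i \<in> {1..<k}" for i l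
    using x that by (simp add: SOL_def inf_eq_0_iff_vec)
  have "min (x 0 $ l) (x j $ l) = 0" for l
  proof -
    have "1 \<le> j" "j \<le> k" using j by auto
    then show ?thesis
    proof (induction j rule: dec_induct)
      case base
      show ?case by (rule x01)
    next
      case (step i)
      then have i: "i \<in> {1..<k}" by auto
      then have "0 < d i $ l" using d by (auto simp: pos_vecs_def)
      \<comment> \<open>If entry \<open>l\<close> of \<open>x 0\<close> is positive, that of
        \<open>x i\<close> is 0, so \<open>d i - x i\<close> is positive there and
        \<open>x (i + 1)\<close> vanishes. If it is 0, the minimum is 0 because \<open>chain\<close>
        makes \<open>x (i + 1)\<close> nonnegative.\<close>
      then show ?case using step chain[OF i, of l] by (auto simp: min_def split: if_splits)
    qed
  qed
  then show ?thesis by (simp add: inf_eq_0_iff_vec)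
qed

text \<open>Extensionality amounts to the factor \<open>{undefined}\<close> at every index above
  \<open>k\<close>. The set is thus a product of compact sets over all naturals, and Tychonoff's
  theorem applies.\<close>

lemma compact_PiE_cball:
  fixes k :: nat
  shows "compact ({0..k} \<rightarrow>\<^sub>E cball (0 :: real ^ 'n) r)"
proof -
  let ?A = "\<lambda>i. if i \<le> k then cball (0 :: real ^ 'n) r else {undefined}"
  have "compactin (product_topology (\<lambda>i. euclidean) UNIV) (PiE UNIV ?A)"
    by (auto simp: compactin_PiE)
  moreover have "PiE UNIV ?A = {0..k} \<rightarrow>\<^sub>E cball 0 r"
    by (auto simp: PiE_def Pi_def extensional_def split: if_splits)
  ultimately show ?thesis
    by (simp add: euclidean_product_topology)
qed

lemma R0_W_residual_lower_bound:
  fixes C :: "nat \<Rightarrow> real ^ 'n ^ 'n"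
  assumes "R0_W k C"
  shows "\<exists>c>0. \<forall>x. (\<forall>j\<in>{1..k}. inf (x 0) (x j) = 0) \<longrightarrow>
       c * L2_set (\<lambda>i. norm (x i)) {0..k} \<le> norm (C 0 *v x 0 - (\<Sum>i=1..k. C i *v x i))"
proof -
  define N :: "(nat \<Rightarrow> real ^ 'n) \<Rightarrow> real" where "N x = L2_set (\<lambda>i. norm (x i)) {0..k}" for x
  define F where "F x = norm (C 0 *v x 0 - (\<Sum>i=1..k. C i *v x i))" for x
  \<comment> \<open>The unit sphere of the cone, cut out by closed conditions from a compact product
    of balls.\<close>
  define K where "K = {x \<in> {0..k} \<rightarrow>\<^sub>E cball 0 1. N x = 1 \<and>
    (\<forall>j\<in>{1..k}. \<forall>l. min (x 0 $ l) (x j $ l) = 0)}"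
  have cont: "continuous_on UNIV N" "continuous_on UNIV F"
    unfolding N_def F_def L2_set_def
    by (intro continuous_intros continuous_on_product_coordinates
        continuous_on_compose2[OF matrix_vector_mult_linear_continuous_on _ subset_UNIV])+
  have "continuous_on UNIV (\<lambda>x :: nat \<Rightarrow> real ^ 'n. min (x 0 $ l) (x j $ l))" for j l
    by (intro continuous_on_min continuous_on_component continuous_on_product_coordinates)
  then have "closed {x :: nat \<Rightarrow> real ^ 'n. min (x 0 $ l) (x j $ l) = 0}" for j l
    by (intro closed_Collect_eq continuous_on_const)
  moreover have "closed {x. N x = 1}"
    by (intro closed_Collect_eq continuous_on_const cont)
  ultimately have "closed {x. N x = 1 \<and> (\<forall>j\<in>{1..k}. \<forall>l. min (x 0 $ l) (x j $ l) = 0)}"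
    unfolding Ball_def
    by (intro closed_Collect_conj closed_Collect_all closed_Collect_imp open_Collect_const)
  from compact_Int_closed[OF compact_PiE_cball this, of k 1] have "compact K"
    by (rule back_subst[of compact]) (auto simp: K_def)
  have F_pos: "0 < F z" if "z \<in> K" for z
  proof (rule ccontr)
    assume "\<not> 0 < F z"
    then have "C 0 *v z 0 = (\<Sum>i=1..k. C i *v z i)" by (simp add: F_def)
    moreover have "z \<in> {0..k} \<rightarrow>\<^sub>E UNIV" "\<forall>j\<in>{1..k}. inf (z 0) (z j) = 0"
      using that by (auto simp: K_def inf_eq_0_iff_vec)
    ultimately have "\<forall>i\<in>{0..k}. z i = 0"
      using assms unfolding R0_W_def by blast
    then have "N z = 0" by (simp add: N_def L2_set_def)
    then show False using that by (simp add: K_def)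
  qed
  obtain c where c: "c > 0" "\<And>z. z \<in> K \<Longrightarrow> c \<le> F z"
  \<comment> \<open>A minimum of \<open>F\<close> exists only on nonempty \<open>K\<close>;
    otherwise any positive constant serves.\<close>
  proof (cases "K = {}")
    case True
    then show ?thesis using that[of 1] by simp
  next
    case False
    then obtain z where "z \<in> K" "\<forall>y\<in>K. F z \<le> F y"
      using continuous_attains_inf[OF \<open>compact K\<close>] continuous_on_subset[OF cont(2)] by blast
    then show ?thesis using that[of "F z"] F_pos by blast
  qed
  have "c * N x \<le> F x" if x: "\<forall>j\<in>{1..k}. inf (x 0) (x j) = 0" for x
  proof (cases "N x = 0")
    case True
    then show ?thesis by (simp add: F_def)
  next
    case False
    then have pos: "N x > 0" using L2_set_nonneg[of _ "{0..k}"] unfolding N_def by (metis order_le_less)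
    \<comment> \<open>Radial projection to the unit sphere. The restriction is there because
      \<open>x\<close> is an arbitrary function, whereas members of \<open>K\<close> are
      \<open>undefined\<close> above \<open>k\<close>.\<close>
    define z where "z = restrict (\<lambda>i. inverse (N x) *\<^sub>R x i) {0..k}"
    have "norm (z i) = inverse (N x) * norm (x i)" if "i \<in> {0..k}" for i
      using pos that by (simp add: z_def)
    then have "N z = L2_set (\<lambda>i. inverse (N x) * norm (x i)) {0..k}"
      unfolding N_def[of z] by (intro L2_set_cong) auto
    also have "\<dots> = inverse (N x) * N x"
      using L2_set_right_distrib[of "inverse (N x)" "\<lambda>i. norm (x i)" "{0..k}"] pos
      by (simp only: N_def[symmetric]) simp
    finally have Nz: "N z = 1" using pos by simp
    \<comment> \<open>No entry exceeds the Euclidean norm of the tuple, so \<open>z\<close> lies in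
      the product of unit balls.\<close>
    have "norm (z i) \<le> 1" if "i \<in> {0..k}" for i
      using member_le_L2_set[of "{0..k}" i "\<lambda>i. norm (z i)"] that Nz by (simp add: N_def)
    moreover have "inf (z 0) (z j) = 0" if "j \<in> {1..k}" for j
      using inf_scaleR_eq_0[OF bspec[OF x that], of "inverse (N x)"] pos that by (simp add: z_def)
    ultimately have "z \<in> K"
      using Nz by (auto simp: K_def inf_eq_0_iff_vec z_def)
    then have "c \<le> F z" by (rule c)
    also have "F z = inverse (N x) * F x"
    proof -
      have "C 0 *v z 0 - (\<Sum>i=1..k. C i *v z i)
          = inverse (N x) *\<^sub>R (C 0 *v x 0 - (\<Sum>i=1..k. C i *v x i))"
        by (simp add: z_def matrix_vector_mult_scaleR scaleR_sum_right scaleR_diff_right)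
      then show ?thesis using pos by (simp add: F_def)
    qed
    finally show ?thesis using pos by (simp add: field_simps)
  qed
  with c(1) show ?thesis unfolding N_def F_def by blast
qed

theorem theorem3p2:
  fixes k :: nat and C :: "nat \<Rightarrow> real ^ 'n ^ 'n"
  assumes "k \<ge> 1" and "R0_W k C"
  shows "\<forall>q :: real ^ 'n. \<forall>d :: nat \<Rightarrow> real ^ 'n. d \<in> {1..<k} \<rightarrow> pos_vecs \<longrightarrow> tuples_bounded k (SOL k C d q)"
proof (intro allI impI)
  fix q :: "real ^ 'n" and d :: "nat \<Rightarrow> real ^ 'n"
  assume d: "d \<in> {1..<k} \<rightarrow> pos_vecs"
  obtain c where c: "c > 0"
    "\<And>x. (\<forall>j\<in>{1..k}. inf (x 0) (x j) = 0) \<Longrightarrow>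
       c * L2_set (\<lambda>i. norm (x i)) {0..k} \<le> norm (C 0 *v x 0 - (\<Sum>i=1..k. C i *v x i))"
    using R0_W_residual_lower_bound[OF assms(2)] by blast
  \<comment> \<open>The constant \<open>c\<close> comes from \<open>C\<close> and \<open>k\<close>
    alone, so this bound is the same for every \<open>d\<close>.\<close>
  have "L2_set (\<lambda>i. norm (x i)) {0..k} \<le> norm q / c" if x: "x \<in> SOL k C d q" for x
  proof -
    have "C 0 *v x 0 - (\<Sum>i=1..k. C i *v x i) = q"
      using x by (simp add: SOL_def)
    moreover have "c * L2_set (\<lambda>i. norm (x i)) {0..k} \<le> norm (C 0 *v x 0 - (\<Sum>i=1..k. C i *v x i))"
      by (intro c(2) ballI SOL_inf_eq_0[OF x d])
    ultimately show ?thesis using c(1)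
      by (simp add: field_simps)
  qed
  then show "tuples_bounded k (SOL k C d q)"
    unfolding tuples_bounded_def by blast
qed

end
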